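(* The variety $\mathsf{Nil}_2(\mathsf{Grp})$ of $2$-nilpotent groups is not locally algebraically cartesian closed.
   Context: A group $G$ is $2$-nilpotent if it is nilpotent of class at most $2$, i.e. $[G,G]\subseteq \mathrm{Z}(G)$. $\mathsf{Nil}_2(\mathsf{Grp})$ is the full subcategory of the category of groups on the $2$-nilpotent groups; it is a semi-abelian variety. Let $\mathcal{C}$ be a semi-abelian category. For an object $B$ of $\mathcal{C}$, the category $\mathsf{Pt}_B(\mathcal{C})$ of points over $B$ has as objects the triples $(A,p\colon A\to B,s\colon B\to A)$ with $p\circ s=\mathrm{id}_B$, and as morphisms the morphisms $A\to A'$ commuting with the $p$'s and the $s$'s. Every morphism $f\colon E\to B$ in $\mathcal{C}$ induces by pullback a change-of-base functor $f^*\colon\mathsf{Pt}_B(\mathcal{C})\to\mathsf{Pt}_E(\mathcal{C})$. $\mathcal{C}$ is locally algebraically cartesian closed (LACC) when all these change-of-base functors are left adjoints (i.e. have right adjoints). When $\mathcal{C}$ is a variety of algebras, it is known that LACC is equivalent to the following: for all objects $B,X,Y$ of $\mathcal{C}$ the canonical comparison morphism $(B\flat X)+(B\flat Y)\to B\flat(X+Y)$ is an isomorphism, where $+$ is the coproduct in $\mathcal{C}$, $B\flat X$ is the kernel of $[\mathrm{id}_B,0]\colon B+X\to B$, and the comparison morphism is induced by applying the functor $B\flat(-)$ to the coproduct injections $X\to X+Y$ and $Y\to X+Y$. *)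

theory Defs
  imports "HOL-Algebra.Generated_Groups" "HOL-Library.Equipollence"
begin

section \<open>Categories, functors, adjunctions\<close>

record ('o, 'm) cat =
  Obj :: "'o set"
  Arr :: "'m set"
  Dom :: "'m \<Rightarrow> 'o"
  Cod :: "'m \<Rightarrow> 'o"
  Idt :: "'o \<Rightarrow> 'm"
  Cmp :: "'m \<Rightarrow> 'm \<Rightarrow> 'm" (infixr \<open>\<star>\<index>\<close> 70)

definition Hom :: "('o, 'm, 'z) cat_scheme \<Rightarrow> 'o \<Rightarrow> 'o \<Rightarrow> 'm set" where
  "Hom C A B = {f \<in> Arr C. Dom C f = A \<and> Cod C f = B}"

definition is_category :: "('o, 'm, 'z) cat_scheme \<Rightarrow> bool" where
  "is_category C \<longleftrightarrow>
     (\<forall>f\<in>Arr C. Dom C f \<in> Obj C \<and> Cod C f \<in> Obj C) \<and>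
     (\<forall>A\<in>Obj C. Idt C A \<in> Hom C A A) \<and>
     (\<forall>f\<in>Arr C. \<forall>g\<in>Arr C. Cod C f = Dom C g \<longrightarrow> g \<star>\<^bsub>C\<^esub> f \<in> Hom C (Dom C f) (Cod C g)) \<and>
     (\<forall>f\<in>Arr C. f \<star>\<^bsub>C\<^esub> Idt C (Dom C f) = f \<and> Idt C (Cod C f) \<star>\<^bsub>C\<^esub> f = f) \<and>
     (\<forall>f\<in>Arr C. \<forall>g\<in>Arr C. \<forall>h\<in>Arr C. Cod C f = Dom C g \<longrightarrow> Cod C g = Dom C h \<longrightarrow>
        h \<star>\<^bsub>C\<^esub> (g \<star>\<^bsub>C\<^esub> f) = (h \<star>\<^bsub>C\<^esub> g) \<star>\<^bsub>C\<^esub> f)"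

record ('o, 'm, 'p, 'n) fctr =
  FObj :: "'o \<Rightarrow> 'p"
  FArr :: "'m \<Rightarrow> 'n"

definition is_functor ::
  "('o, 'm, 'z) cat_scheme \<Rightarrow> ('p, 'n, 'y) cat_scheme \<Rightarrow> ('o, 'm, 'p, 'n) fctr \<Rightarrow> bool" where
  "is_functor C D F \<longleftrightarrow>
     (\<forall>A\<in>Obj C. FObj F A \<in> Obj D \<and> FArr F (Idt C A) = Idt D (FObj F A)) \<and>
     (\<forall>f\<in>Arr C. FArr F f \<in> Hom D (FObj F (Dom C f)) (FObj F (Cod C f))) \<and>
     (\<forall>f\<in>Arr C. \<forall>g\<in>Arr C. Cod C f = Dom C g \<longrightarrow>
        FArr F (g \<star>\<^bsub>C\<^esub> f) = FArr F g \<star>\<^bsub>D\<^esub> FArr F f)"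

text \<open>An adjunction between \<open>F : C \<rightarrow> D\<close> (left) and \<open>G : D \<rightarrow> C\<close> (right) is given by
  bijections \<open>\<phi> X Y : D(F X, Y) \<rightarrow> C(X, G Y)\<close>, natural in \<open>X\<close> and \<open>Y\<close>.\<close>

definition is_adjunction ::
  "('o, 'm, 'z) cat_scheme \<Rightarrow> ('p, 'n, 'y) cat_scheme \<Rightarrow> ('o, 'm, 'p, 'n) fctr \<Rightarrow>
   ('p, 'n, 'o, 'm) fctr \<Rightarrow> ('o \<Rightarrow> 'p \<Rightarrow> 'n \<Rightarrow> 'm) \<Rightarrow> bool" where
  "is_adjunction C D F G \<phi> \<longleftrightarrow>
     (\<forall>X\<in>Obj C. \<forall>Y\<in>Obj D. bij_betw (\<phi> X Y) (Hom D (FObj F X) Y) (Hom C X (FObj G Y))) \<and>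
     (\<forall>f\<in>Arr C. \<forall>g\<in>Arr D. \<forall>h\<in>Hom D (FObj F (Cod C f)) (Dom D g).
        \<phi> (Dom C f) (Cod D g) (g \<star>\<^bsub>D\<^esub> h \<star>\<^bsub>D\<^esub> FArr F f) =
        FArr G g \<star>\<^bsub>C\<^esub> \<phi> (Cod C f) (Dom D g) h \<star>\<^bsub>C\<^esub> f)"

definition has_right_adjoint ::
  "('o, 'm, 'z) cat_scheme \<Rightarrow> ('p, 'n, 'y) cat_scheme \<Rightarrow> ('o, 'm, 'p, 'n) fctr \<Rightarrow> bool" where
  "has_right_adjoint C D F \<longleftrightarrow> (\<exists>G \<phi>. is_functor D C G \<and> is_adjunction C D F G \<phi>)"


section \<open>Points, change of base, local algebraic cartesian closedness\<close>

type_synonym ('o, 'm) point = "'o \<times> 'm \<times> 'm"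

definition is_point :: "('o, 'm, 'z) cat_scheme \<Rightarrow> 'o \<Rightarrow> ('o, 'm) point \<Rightarrow> bool" where
  "is_point C B = (\<lambda>(A, p, s). p \<in> Hom C A B \<and> s \<in> Hom C B A \<and> p \<star>\<^bsub>C\<^esub> s = Idt C B)"

text \<open>A morphism of points carries its domain and codomain, since the underlying arrow of \<open>C\<close>
  does not determine the \<open>p\<close>'s and \<open>s\<close>'s.\<close>

definition Pt :: "('o, 'm, 'z) cat_scheme \<Rightarrow> 'o \<Rightarrow>
    (('o, 'm) point, ('o, 'm) point \<times> 'm \<times> ('o, 'm) point) cat" where
  "Pt C B = \<lparr>
     Obj = {X. is_point C B X},
     Arr = {((A, p, s), h, (A', p', s')) | A p s h A' p' s'.
              is_point C B (A, p, s) \<and> is_point C B (A', p', s') \<and>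
              h \<in> Hom C A A' \<and> p' \<star>\<^bsub>C\<^esub> h = p \<and> h \<star>\<^bsub>C\<^esub> s = s'},
     Dom = (\<lambda>(X, h, Y). X),
     Cod = (\<lambda>(X, h, Y). Y),
     Idt = (\<lambda>X. (X, Idt C (fst X), X)),
     Cmp = (\<lambda>(Y, k, Z) (X, h, Y'). (X, k \<star>\<^bsub>C\<^esub> h, Z))\<rparr>"

definition is_pullback ::
  "('o, 'm, 'z) cat_scheme \<Rightarrow> 'm \<Rightarrow> 'm \<Rightarrow> 'o \<Rightarrow> 'm \<Rightarrow> 'm \<Rightarrow> bool" where
  "is_pullback C f p P u v \<longleftrightarrow>
     P \<in> Obj C \<and> u \<in> Hom C P (Dom C f) \<and> v \<in> Hom C P (Dom C p) \<and> f \<star>\<^bsub>C\<^esub> u = p \<star>\<^bsub>C\<^esub> v \<and>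
     (\<forall>Q\<in>Obj C. \<forall>a\<in>Hom C Q (Dom C f). \<forall>b\<in>Hom C Q (Dom C p). f \<star>\<^bsub>C\<^esub> a = p \<star>\<^bsub>C\<^esub> b \<longrightarrow>
        (\<exists>!w. w \<in> Hom C Q P \<and> u \<star>\<^bsub>C\<^esub> w = a \<and> v \<star>\<^bsub>C\<^esub> w = b))"

definition chosen_pullback :: "('o, 'm, 'z) cat_scheme \<Rightarrow> 'm \<Rightarrow> 'm \<Rightarrow> 'o \<times> 'm \<times> 'm" where
  "chosen_pullback C f p = (SOME (P, u, v). is_pullback C f p P u v)"

text \<open>For \<open>f : E \<rightarrow> B\<close>, the functor \<open>f\<^sup>* : Pt\<^sub>B(C) \<rightarrow> Pt\<^sub>E(C)\<close> sends \<open>(A, p, s)\<close> to the chosen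
  pullback of \<open>p\<close> along \<open>f\<close>, with the section induced by \<open>id\<^sub>E\<close> and \<open>s \<circ> f\<close>, and sends a morphism
  \<open>h\<close> to the arrow it induces between the pullbacks.\<close>

definition change_of_base_obj ::
  "('o, 'm, 'z) cat_scheme \<Rightarrow> 'm \<Rightarrow> ('o, 'm) point \<Rightarrow> ('o, 'm) point" where
  "change_of_base_obj C f = (\<lambda>(A, p, s).
     let (P, u, v) = chosen_pullback C f p
     in (P, u, THE t. t \<in> Hom C (Dom C f) P \<and> u \<star>\<^bsub>C\<^esub> t = Idt C (Dom C f) \<and>
                       v \<star>\<^bsub>C\<^esub> t = s \<star>\<^bsub>C\<^esub> f))"

definition change_of_base_arr ::
  "('o, 'm, 'z) cat_scheme \<Rightarrow> 'm \<Rightarrow> ('o, 'm) point \<times> 'm \<times> ('o, 'm) point \<Rightarrow>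
   ('o, 'm) point \<times> 'm \<times> ('o, 'm) point" where
  "change_of_base_arr C f = (\<lambda>((A, p, s), h, (A', p', s')).
     let (P, u, v) = chosen_pullback C f p; (P', u', v') = chosen_pullback C f p'
     in (change_of_base_obj C f (A, p, s),
         THE k. k \<in> Hom C P P' \<and> u' \<star>\<^bsub>C\<^esub> k = u \<and> v' \<star>\<^bsub>C\<^esub> k = h \<star>\<^bsub>C\<^esub> v,
         change_of_base_obj C f (A', p', s')))"

definition change_of_base :: "('o, 'm, 'z) cat_scheme \<Rightarrow> 'm \<Rightarrow>
    (('o, 'm) point, ('o, 'm) point \<times> 'm \<times> ('o, 'm) point,
     ('o, 'm) point, ('o, 'm) point \<times> 'm \<times> ('o, 'm) point) fctr" where
  "change_of_base C f = \<lparr>FObj = change_of_base_obj C f, FArr = change_of_base_arr C f\<rparr>"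

definition LACC :: "('o, 'm, 'z) cat_scheme \<Rightarrow> bool" where
  "LACC C \<longleftrightarrow>
     (\<forall>f\<in>Arr C. has_right_adjoint (Pt C (Cod C f)) (Pt C (Dom C f)) (change_of_base C f))"


section \<open>The category of 2-nilpotent groups\<close>

definition center :: "('a, 'b) monoid_scheme \<Rightarrow> 'a set" where
  "center G = {z \<in> carrier G. \<forall>g\<in>carrier G. z \<otimes>\<^bsub>G\<^esub> g = g \<otimes>\<^bsub>G\<^esub> z}"

definition two_nilpotent :: "('a, 'b) monoid_scheme \<Rightarrow> bool" where
  "two_nilpotent G \<longleftrightarrow> group G \<and> derived G (carrier G) \<subseteq> center G"

text \<open>HOL has no type of all groups, so smallness is made explicit: \<open>U\<close> is the class of sets that
  may serve as carriers. It contains an infinite set and is closed under passing to sets of at most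
  the same cardinality, hence (up to bijection) also under finite products. For instance \<open>U\<close> may consist of all
  subsets of an infinite type, or of the sets of size less than a given uncountable (e.g.
  inaccessible) cardinal; the latter case is the category of groups small in a Grothendieck
  universe.\<close>

definition carrier_class :: "'u set set \<Rightarrow> bool" where
  "carrier_class U \<longleftrightarrow> (\<exists>A\<in>U. infinite A) \<and> (\<forall>A\<in>U. \<forall>A'. A' \<lesssim> A \<longrightarrow> A' \<in> U)"

text \<open>Homomorphisms are made extensional so that equality of arrows is equality on the carrier.\<close>

definition Nil2Grp ::
  "'u set set \<Rightarrow> ('u monoid, 'u monoid \<times> ('u \<Rightarrow> 'u) \<times> 'u monoid) cat" where
  "Nil2Grp U = (let Ob = {G. two_nilpotent G \<and> carrier G \<in> U} in \<lparr>
     Obj = Ob,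
     Arr = {(G, h, H) | G h H. G \<in> Ob \<and> H \<in> Ob \<and> h \<in> hom G H \<inter> extensional (carrier G)},
     Dom = (\<lambda>(G, h, H). G),
     Cod = (\<lambda>(G, h, H). H),
     Idt = (\<lambda>G. (G, restrict id (carrier G), G)),
     Cmp = (\<lambda>(H, k, K) (G, h, H'). (G, compose (carrier G) k h, K))\<rparr>)"

end

theory Submission
  imports Defs "HOL-Algebra.Weak_Morphisms"
begin

text \<open>Let \<open>A\<close> be the Heisenberg group over the field with two elements, \<open>a\<close>, \<open>x\<close> its standard
  generators and \<open>z = [a, x]\<close>. It is a point over \<open>B = \<langle>a\<rangle>\<close>, with kernel the elementary abelian group
  \<open>K = \<langle>x, z\<rangle>\<close>. Change of base along \<open>1 \<rightarrow> B\<close> takes kernels. If it had a right adjoint, every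
  homomorphism \<open>h : K \<rightarrow> H\<close> would factor as the counit at \<open>H\<close> after the restriction to kernels of a
  morphism \<open>\<alpha> : A \<rightarrow> R\<close>, where the point \<open>R\<close> depends only on \<open>H\<close>. Given two homomorphisms \<open>h1\<close> and \<open>h2\<close>
  with associated \<open>\<alpha>\<close> and \<open>\<beta>\<close>, the element \<open>\<alpha> z = [\<alpha> a, \<alpha> x]\<close> is central in \<open>R\<close>, hence commutes
  with \<open>\<beta> x\<close>, so \<open>h1 z\<close> commutes with \<open>h2 x\<close>. But \<open>h1\<close> and \<open>h2\<close> into \<open>H = A\<close> can be chosen so
  that \<open>h1 z\<close> and \<open>h2 x\<close> are arbitrary elements of order two.\<close>

section \<open>Adjunctions and change of base\<close>

lemma category_Hom_comp:
  assumes "is_category C" "f \<in> Hom C X Y" "g \<in> Hom C Y Z"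
  shows "g \<star>\<^bsub>C\<^esub> f \<in> Hom C X Z"
  using assms unfolding is_category_def Hom_def by fastforce

lemma category_assoc:
  assumes "is_category C" "f \<in> Hom C W X" "g \<in> Hom C X Y" "h \<in> Hom C Y Z"
  shows "h \<star>\<^bsub>C\<^esub> (g \<star>\<^bsub>C\<^esub> f) = (h \<star>\<^bsub>C\<^esub> g) \<star>\<^bsub>C\<^esub> f"
  using assms unfolding is_category_def Hom_def by fastforce

lemma category_Idt:
  assumes "is_category C" "X \<in> Obj C"
  shows "Idt C X \<in> Hom C X X"
  using assms unfolding is_category_def by blast

lemma category_comp_Idt:
  assumes "is_category C" "f \<in> Hom C X Y"
  shows "f \<star>\<^bsub>C\<^esub> Idt C X = f" "Idt C Y \<star>\<^bsub>C\<^esub> f = f"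
  using assms unfolding is_category_def Hom_def by fastforce+

lemma category_Hom_Obj:
  assumes "is_category C" "f \<in> Hom C X Y"
  shows "X \<in> Obj C" "Y \<in> Obj C"
  using assms unfolding is_category_def Hom_def by fastforce+

lemma HomD:
  assumes "f \<in> Hom C X Y"
  shows "f \<in> Arr C" "Dom C f = X" "Cod C f = Y"
  using assms by (auto simp: Hom_def)

text \<open>\<open>R\<close> is the value of the right adjoint at \<open>Y\<close>, and
  \<open>e\<close> is the counit, the arrow whose transpose is the identity of \<open>R\<close>. The
  transpose of \<open>h\<close> is the required factor. Both \<open>R\<close> and \<open>e\<close>
  are fixed before \<open>X\<close> and \<open>h\<close>; the later argument rests on this
  uniformity.\<close>

lemma right_adjoint_factorization:
  assumes C: "is_category C" and D: "is_category D"
    and F: "\<And>f X X'. f \<in> Hom C X X' \<Longrightarrow> FArr F f \<in> Hom D (FObj F X) (FObj F X')"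
    and "has_right_adjoint C D F" and Y: "Y \<in> Obj D"
  obtains R e where "R \<in> Obj C" "e \<in> Hom D (FObj F R) Y"
    "\<And>X h. X \<in> Obj C \<Longrightarrow> h \<in> Hom D (FObj F X) Y \<Longrightarrow> \<exists>a\<in>Hom C X R. h = e \<star>\<^bsub>D\<^esub> FArr F a"
proof -
  obtain G \<phi> where G: "is_functor D C G" and adj: "is_adjunction C D F G \<phi>"
    using assms(4) unfolding has_right_adjoint_def by blast
  have bij: "bij_betw (\<phi> X Y) (Hom D (FObj F X) Y) (Hom C X (FObj G Y))" if "X \<in> Obj C" for X
    using adj Y that unfolding is_adjunction_def by blast
  have nat: "\<phi> (Dom C f) (Cod D g) (g \<star>\<^bsub>D\<^esub> h \<star>\<^bsub>D\<^esub> FArr F f) =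
      FArr G g \<star>\<^bsub>C\<^esub> \<phi> (Cod C f) (Dom D g) h \<star>\<^bsub>C\<^esub> f"
    if "f \<in> Arr C" "g \<in> Arr D" "h \<in> Hom D (FObj F (Cod C f)) (Dom D g)" for f g h
    using adj that unfolding is_adjunction_def by blast
  define R where "R = FObj G Y"
  have R: "R \<in> Obj C" and GI: "FArr G (Idt D Y) = Idt C R"
    using G Y unfolding is_functor_def R_def by auto
  obtain e where e: "e \<in> Hom D (FObj F R) Y" and phi_e: "\<phi> R Y e = Idt C R"
    using bij[OF R] category_Idt[OF C R] unfolding R_def bij_betw_def by (metis imageE)
  have "\<exists>a\<in>Hom C X R. h = e \<star>\<^bsub>D\<^esub> FArr F a" if X: "X \<in> Obj C" and h: "h \<in> Hom D (FObj F X) Y" for X h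
  proof
    let ?a = "\<phi> X Y h"
    show a: "?a \<in> Hom C X R"
      using bij[OF X] h unfolding R_def bij_betw_def by blast
    have eFa: "e \<star>\<^bsub>D\<^esub> FArr F ?a \<in> Hom D (FObj F X) Y"
      using category_Hom_comp[OF D F[OF a] e] .
    have I: "Idt D Y \<in> Hom D Y Y" by (rule category_Idt[OF D Y])
    \<comment> \<open>Naturality is used with \<open>?a\<close> on the source side and the identity
      on the target side. It shows that \<open>e\<close> after \<open>FArr F ?a\<close> has the same
      transpose as \<open>h\<close>.\<close>
    have "\<phi> X Y (Idt D Y \<star>\<^bsub>D\<^esub> e \<star>\<^bsub>D\<^esub> FArr F ?a) = Idt C R \<star>\<^bsub>C\<^esub> Idt C R \<star>\<^bsub>C\<^esub> ?a"
      using nat[of ?a "Idt D Y" e] e HomD[OF a] HomD[OF I] GI phi_e by simp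
    then have "\<phi> X Y (e \<star>\<^bsub>D\<^esub> FArr F ?a) = ?a"
      by (simp add: category_comp_Idt[OF D eFa] category_comp_Idt[OF C a])
    then show "h = e \<star>\<^bsub>D\<^esub> FArr F ?a"
      using bij[OF X] h eFa unfolding bij_betw_def inj_on_def by metis
  qed
  with R e show thesis by (rule that)
qed

section \<open>The category of points\<close>

lemma is_point_iff:
  "is_point C B (A, p, s) \<longleftrightarrow> p \<in> Hom C A B \<and> s \<in> Hom C B A \<and> p \<star>\<^bsub>C\<^esub> s = Idt C B"
  by (simp add: is_point_def)

lemma Obj_Pt [simp]: "X \<in> Obj (Pt C B) \<longleftrightarrow> is_point C B X"
  by (simp add: Pt_def)

lemma Hom_Pt:
  "F \<in> Hom (Pt C B) (A, p, s) (A', p', s') \<longleftrightarrow>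
     (\<exists>h. F = ((A, p, s), h, (A', p', s')) \<and> is_point C B (A, p, s) \<and> is_point C B (A', p', s') \<and>
        h \<in> Hom C A A' \<and> p' \<star>\<^bsub>C\<^esub> h = p \<and> h \<star>\<^bsub>C\<^esub> s = s')"
  by (auto simp: Hom_def Pt_def)

lemma Cmp_Pt [simp]: "(Y, k, Z) \<star>\<^bsub>Pt C B\<^esub> (X, h, Y') = (X, k \<star>\<^bsub>C\<^esub> h, Z)"
  by (simp add: Pt_def)

lemma is_category_Pt:
  assumes C: "is_category C"
  shows "is_category (Pt C B)"
proof -
  have arr: "(X, h, Y) \<in> Arr (Pt C B) \<longleftrightarrow> is_point C B X \<and> is_point C B Y \<and> h \<in> Hom C (fst X) (fst Y) \<and>
      fst (snd Y) \<star>\<^bsub>C\<^esub> h = fst (snd X) \<and> h \<star>\<^bsub>C\<^esub> snd (snd X) = snd (snd Y)" for X h Y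
    by (cases X; cases Y) (auto simp: Pt_def)
  have dc: "Dom (Pt C B) (X, h, Y) = X" "Cod (Pt C B) (X, h, Y) = Y"
    "Idt (Pt C B) X = (X, Idt C (fst X), X)" for X h Y
    by (auto simp: Pt_def)
  show ?thesis
    unfolding is_category_def
  proof (intro conjI ballI impI)
    fix X assume "X \<in> Obj (Pt C B)"
    then obtain A p s where X: "X = (A, p, s)" and P: "is_point C B (A, p, s)"
      by (cases X) auto
    then have p: "p \<in> Hom C A B" and s: "s \<in> Hom C B A"
      by (simp_all add: is_point_iff)
    have "Idt C A \<in> Hom C A A"
      by (intro category_Idt[OF C] category_Hom_Obj[OF C p])
    then show "Idt (Pt C B) X \<in> Hom (Pt C B) X X"
      by (simp add: X P Hom_Pt dc category_comp_Idt[OF C p] category_comp_Idt[OF C s])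
  next
    fix f g assume fg: "f \<in> Arr (Pt C B)" "g \<in> Arr (Pt C B)" "Cod (Pt C B) f = Dom (Pt C B) g"
    obtain X h Y k Z where f: "f = (X, h, Y)" "g = (Y, k, Z)"
      using fg(3) by (cases f; cases g) (simp add: dc)
    obtain A p s A' p' s' A'' p'' s'' where X: "X = (A, p, s)" "Y = (A', p', s')" "Z = (A'', p'', s'')"
      by (cases X; cases Y; cases Z)
    have P: "is_point C B (A, p, s)" "is_point C B (A', p', s')" "is_point C B (A'', p'', s'')"
      and h: "h \<in> Hom C A A'" "p' \<star>\<^bsub>C\<^esub> h = p" "h \<star>\<^bsub>C\<^esub> s = s'"
      and k: "k \<in> Hom C A' A''" "p'' \<star>\<^bsub>C\<^esub> k = p'" "k \<star>\<^bsub>C\<^esub> s' = s''"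
      using fg(1,2) unfolding f X by (simp_all add: arr)
    have p'': "p'' \<in> Hom C A'' B" and s: "s \<in> Hom C B A"
      using P by (simp_all add: is_point_iff)
    have "p'' \<star>\<^bsub>C\<^esub> k \<star>\<^bsub>C\<^esub> h = p" "(k \<star>\<^bsub>C\<^esub> h) \<star>\<^bsub>C\<^esub> s = s''"
      using category_assoc[OF C h(1) k(1) p''] category_assoc[OF C s h(1) k(1)] h k by simp_all
    then show "g \<star>\<^bsub>Pt C B\<^esub> f \<in> Hom (Pt C B) (Dom (Pt C B) f) (Cod (Pt C B) g)"
      using category_Hom_comp[OF C h(1) k(1)] by (simp add: Hom_Pt f dc X P)
  next
    fix f g h assume "f \<in> Arr (Pt C B)" "g \<in> Arr (Pt C B)" "h \<in> Arr (Pt C B)"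
      "Cod (Pt C B) f = Dom (Pt C B) g" "Cod (Pt C B) g = Dom (Pt C B) h"
    then obtain X1 X2 X3 X4 f' g' h' where e: "f = (X1, f', X2)" "g = (X2, g', X3)" "h = (X3, h', X4)"
      and "f' \<in> Hom C (fst X1) (fst X2)" "g' \<in> Hom C (fst X2) (fst X3)" "h' \<in> Hom C (fst X3) (fst X4)"
      by (cases f; cases g; cases h) (auto simp: arr dc)
    then show "h \<star>\<^bsub>Pt C B\<^esub> (g \<star>\<^bsub>Pt C B\<^esub> f) = (h \<star>\<^bsub>Pt C B\<^esub> g) \<star>\<^bsub>Pt C B\<^esub> f"
      unfolding e Cmp_Pt by (metis category_assoc[OF C])
  next
    fix f assume "f \<in> Arr (Pt C B)"
    moreover obtain X Y h where f: "f = (X, h, Y)" by (cases f)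
    ultimately have h: "h \<in> Hom C (fst X) (fst Y)"
      by (simp add: arr)
    show "f \<star>\<^bsub>Pt C B\<^esub> Idt (Pt C B) (Dom (Pt C B) f) = f"
      "Idt (Pt C B) (Cod (Pt C B) f) \<star>\<^bsub>Pt C B\<^esub> f = f"
      by (simp_all add: f dc category_comp_Idt[OF C h])
  qed (auto simp: arr dc)
qed

section \<open>Pullbacks and the change-of-base functor\<close>

lemma is_pullbackD:
  assumes "is_pullback C f p P u v" "f \<in> Hom C E B" "p \<in> Hom C A B"
  shows "P \<in> Obj C" "u \<in> Hom C P E" "v \<in> Hom C P A" "f \<star>\<^bsub>C\<^esub> u = p \<star>\<^bsub>C\<^esub> v"
    "\<And>Q a b. Q \<in> Obj C \<Longrightarrow> a \<in> Hom C Q E \<Longrightarrow> b \<in> Hom C Q A \<Longrightarrow> f \<star>\<^bsub>C\<^esub> a = p \<star>\<^bsub>C\<^esub> b \<Longrightarrow>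
        \<exists>!w. w \<in> Hom C Q P \<and> u \<star>\<^bsub>C\<^esub> w = a \<and> v \<star>\<^bsub>C\<^esub> w = b"
  using assms HomD[OF assms(2)] HomD[OF assms(3)] unfolding is_pullback_def by auto

lemma is_pullback_chosen_pullback:
  assumes "is_pullback C f p P u v"
  shows "case chosen_pullback C f p of (P, u, v) \<Rightarrow> is_pullback C f p P u v"
  unfolding chosen_pullback_def
  by (rule someI[of "\<lambda>(P, u, v). is_pullback C f p P u v" "(P, u, v)"]) (simp add: assms)

text \<open>Since \<open>s\<close> splits \<open>p\<close>, the arrows \<open>Idt C E\<close> and
  \<open>s\<close> after \<open>f\<close> form a cone over \<open>f\<close> and \<open>p\<close>.
  Hence the \<open>THE\<close> in \<open>change_of_base_obj\<close> denotes a genuine induced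
  section. A pullback has to exist for the choice by \<open>SOME\<close> to be one.\<close>

lemma change_of_base_objE:
  assumes C: "is_category C" and f: "f \<in> Hom C E B" and X: "is_point C B (A, p, s)"
    and ex: "\<exists>P u v. is_pullback C f p P u v"
  obtains P u v t where "chosen_pullback C f p = (P, u, v)" "is_pullback C f p P u v"
    "change_of_base_obj C f (A, p, s) = (P, u, t)" "is_point C E (P, u, t)"
    "v \<star>\<^bsub>C\<^esub> t = s \<star>\<^bsub>C\<^esub> f"
proof -
  obtain P u v where ch: "chosen_pullback C f p = (P, u, v)" and pb: "is_pullback C f p P u v"
    using ex is_pullback_chosen_pullback by (metis (no_types, lifting) case_prodE)
  have p: "p \<in> Hom C A B" and s: "s \<in> Hom C B A" and ps: "p \<star>\<^bsub>C\<^esub> s = Idt C B"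
    using X by (auto simp: is_point_iff)
  note pbD = is_pullbackD[OF pb f p]
  have E: "E \<in> Obj C" using category_Hom_Obj[OF C f] by simp
  define t where "t = (THE t. t \<in> Hom C E P \<and> u \<star>\<^bsub>C\<^esub> t = Idt C E \<and> v \<star>\<^bsub>C\<^esub> t = s \<star>\<^bsub>C\<^esub> f)"
  have "f \<star>\<^bsub>C\<^esub> Idt C E = p \<star>\<^bsub>C\<^esub> s \<star>\<^bsub>C\<^esub> f"
    using category_assoc[OF C f s p] ps category_comp_Idt[OF C f] by simp
  then have "\<exists>!t. t \<in> Hom C E P \<and> u \<star>\<^bsub>C\<^esub> t = Idt C E \<and> v \<star>\<^bsub>C\<^esub> t = s \<star>\<^bsub>C\<^esub> f"
    using pbD(5)[OF E category_Idt[OF C E] category_Hom_comp[OF C f s]] by simp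
  from theI'[OF this] have "t \<in> Hom C E P \<and> u \<star>\<^bsub>C\<^esub> t = Idt C E \<and> v \<star>\<^bsub>C\<^esub> t = s \<star>\<^bsub>C\<^esub> f"
    unfolding t_def .
  moreover have "change_of_base_obj C f (A, p, s) = (P, u, t)"
    using HomD(2)[OF f] by (simp add: change_of_base_obj_def ch t_def)
  ultimately show thesis
    using that[OF ch pb] pbD(2) by (simp add: is_point_iff)
qed

text \<open>The arrow \<open>k\<close> is induced by \<open>u\<close> and \<open>h\<close> after
  \<open>v\<close>, so it lies over \<open>E\<close>. It respects the sections because
  \<open>k\<close> after \<open>t\<close> has the same two components as \<open>t'\<close>, namely
  \<open>Idt C E\<close> and \<open>s'\<close> after \<open>f\<close>.\<close>

lemma change_of_base_arrE:
  assumes C: "is_category C" and f: "f \<in> Hom C E B"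
    and ex: "\<And>A p. p \<in> Hom C A B \<Longrightarrow> \<exists>P u v. is_pullback C f p P u v"
    and h: "((A, p, s), h, (A', p', s')) \<in> Hom (Pt C B) (A, p, s) (A', p', s')"
    and ch: "chosen_pullback C f p = (P, u, v)" and ch': "chosen_pullback C f p' = (P', u', v')"
  obtains k where "k \<in> Hom C P P'" "v' \<star>\<^bsub>C\<^esub> k = h \<star>\<^bsub>C\<^esub> v"
    "change_of_base_arr C f ((A, p, s), h, (A', p', s')) =
       (change_of_base_obj C f (A, p, s), k, change_of_base_obj C f (A', p', s'))"
    "change_of_base_arr C f ((A, p, s), h, (A', p', s')) \<in>
       Hom (Pt C E) (change_of_base_obj C f (A, p, s)) (change_of_base_obj C f (A', p', s'))"
proof -
  have X: "is_point C B (A, p, s)" "is_point C B (A', p', s')" and hh: "h \<in> Hom C A A'"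
    and ph: "p' \<star>\<^bsub>C\<^esub> h = p" and hs: "h \<star>\<^bsub>C\<^esub> s = s'" using h by (auto simp: Hom_Pt)
  have p: "p \<in> Hom C A B" and s: "s \<in> Hom C B A" and p': "p' \<in> Hom C A' B"
    using X by (auto simp: is_point_iff)
  obtain t where pb: "is_pullback C f p P u v" and o: "change_of_base_obj C f (A, p, s) = (P, u, t)"
      "is_point C E (P, u, t)" and vt: "v \<star>\<^bsub>C\<^esub> t = s \<star>\<^bsub>C\<^esub> f"
    using change_of_base_objE[OF C f X(1) ex[OF p]] ch by (metis prod.inject)
  obtain t' where pb': "is_pullback C f p' P' u' v'"
      and o': "change_of_base_obj C f (A', p', s') = (P', u', t')" "is_point C E (P', u', t')"
      and vt': "v' \<star>\<^bsub>C\<^esub> t' = s' \<star>\<^bsub>C\<^esub> f"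
    using change_of_base_objE[OF C f X(2) ex[OF p']] ch' by (metis prod.inject)
  note D = is_pullbackD[OF pb f p] and D' = is_pullbackD[OF pb' f p']
  have t: "t \<in> Hom C E P" "u \<star>\<^bsub>C\<^esub> t = Idt C E" and t': "t' \<in> Hom C E P'" "u' \<star>\<^bsub>C\<^esub> t' = Idt C E"
    using o o' by (auto simp: is_point_iff)
  define k where "k = (THE k. k \<in> Hom C P P' \<and> u' \<star>\<^bsub>C\<^esub> k = u \<and> v' \<star>\<^bsub>C\<^esub> k = h \<star>\<^bsub>C\<^esub> v)"
  have "f \<star>\<^bsub>C\<^esub> u = p' \<star>\<^bsub>C\<^esub> h \<star>\<^bsub>C\<^esub> v"
    using category_assoc[OF C D(3) hh p'] ph D(4) by simp
  from theI'[OF D'(5)[OF D(1,2) category_Hom_comp[OF C D(3) hh] this]]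
  have k: "k \<in> Hom C P P'" "u' \<star>\<^bsub>C\<^esub> k = u" "v' \<star>\<^bsub>C\<^esub> k = h \<star>\<^bsub>C\<^esub> v"
    unfolding k_def by auto
  have kt: "k \<star>\<^bsub>C\<^esub> t \<in> Hom C E P'" by (rule category_Hom_comp[OF C t(1) k(1)])
  have "u' \<star>\<^bsub>C\<^esub> k \<star>\<^bsub>C\<^esub> t = Idt C E"
    using category_assoc[OF C t(1) k(1) D'(2)] k(2) t(2) by simp
  moreover have "v' \<star>\<^bsub>C\<^esub> k \<star>\<^bsub>C\<^esub> t = s' \<star>\<^bsub>C\<^esub> f"
  proof -
    have "v' \<star>\<^bsub>C\<^esub> k \<star>\<^bsub>C\<^esub> t = h \<star>\<^bsub>C\<^esub> v \<star>\<^bsub>C\<^esub> t"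
      using category_assoc[OF C t(1) k(1) D'(3)] category_assoc[OF C t(1) D(3) hh] k(3) by simp
    also have "\<dots> = s' \<star>\<^bsub>C\<^esub> f"
      using category_assoc[OF C f s hh] vt hs by simp
    finally show ?thesis .
  qed
  moreover have "f \<star>\<^bsub>C\<^esub> Idt C E = p' \<star>\<^bsub>C\<^esub> s' \<star>\<^bsub>C\<^esub> f"
    using X(2) category_assoc[OF C f _ p', of s'] category_comp_Idt[OF C f] by (simp add: is_point_iff)
  then have "\<exists>!w. w \<in> Hom C E P' \<and> u' \<star>\<^bsub>C\<^esub> w = Idt C E \<and> v' \<star>\<^bsub>C\<^esub> w = s' \<star>\<^bsub>C\<^esub> f"
    using D'(5)[of E "Idt C E" "s' \<star>\<^bsub>C\<^esub> f"] category_Hom_Obj[OF C f] category_Idt[OF C] X(2)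
      category_Hom_comp[OF C f] by (simp add: is_point_iff)
  ultimately have kt': "k \<star>\<^bsub>C\<^esub> t = t'"
    using kt t' vt' by blast
  have e: "change_of_base_arr C f ((A, p, s), h, (A', p', s')) =
       (change_of_base_obj C f (A, p, s), k, change_of_base_obj C f (A', p', s'))"
    by (simp add: change_of_base_arr_def ch ch' k_def)
  show thesis
    by (rule that[OF k(1,3) e]) (use k kt' o o' in \<open>simp add: e Hom_Pt\<close>)
qed

section \<open>2-nilpotent groups\<close>

text \<open>The equation says that the commutator of \<open>x\<close> and \<open>y\<close> is
  central. The center is a subgroup, so it then contains the subgroup generated by all commutators.
  This form spares computing inverses in concrete groups.\<close>

lemma two_nilpotentI:
  fixes G (structure)
  assumes "group G"
    and "\<And>x y. x \<in> carrier G \<Longrightarrow> y \<in> carrier G \<Longrightarrow> \<exists>c\<in>center G. x \<otimes>\<^bsub>G\<^esub> y = c \<otimes>\<^bsub>G\<^esub> (y \<otimes>\<^bsub>G\<^esub> x)"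
  shows "two_nilpotent G"
proof -
  interpret group G by fact
  have "subgroup (center G) G"
  proof (rule subgroupI)
    fix a assume a: "a \<in> center G"
    show "inv a \<in> center G"
      unfolding center_def
    proof (intro CollectI conjI ballI)
      fix g assume g: "g \<in> carrier G"
      have "a \<otimes> inv g = inv g \<otimes> a" and ac: "a \<in> carrier G"
        using a g by (auto simp: center_def)
      then have "inv (a \<otimes> inv g) = inv (inv g \<otimes> a)" by simp
      then show "inv a \<otimes> g = g \<otimes> inv a"
        using ac g by (simp add: inv_mult_group)
    qed (use a in \<open>auto simp: center_def\<close>)
  next
    fix a b assume "a \<in> center G" "b \<in> center G"
    then have ab: "a \<in> carrier G" "b \<in> carrier G"
      and comm: "\<And>g. g \<in> carrier G \<Longrightarrow> a \<otimes> g = g \<otimes> a" "\<And>g. g \<in> carrier G \<Longrightarrow> b \<otimes> g = g \<otimes> b"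
      by (auto simp: center_def)
    have "a \<otimes> b \<otimes> g = g \<otimes> (a \<otimes> b)" if g: "g \<in> carrier G" for g
    proof -
      have "a \<otimes> b \<otimes> g = a \<otimes> g \<otimes> b"
        using ab g comm(2)[OF g] by (simp add: m_assoc)
      also have "\<dots> = g \<otimes> (a \<otimes> b)"
        using ab g by (simp add: comm(1)[OF g] m_assoc)
      finally show ?thesis .
    qed
    then show "a \<otimes> b \<in> center G"
      using ab by (simp add: center_def)
  qed (auto simp: center_def)
  moreover have "derived_set G (carrier G) \<subseteq> center G"
  proof clarify
    fix x y assume x: "x \<in> carrier G" and y: "y \<in> carrier G"
    then obtain c where c: "c \<in> center G" "x \<otimes> y = c \<otimes> (y \<otimes> x)" using assms(2) by blast
    moreover from c have "c \<in> carrier G" by (simp add: center_def)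
    ultimately have "x \<otimes> y \<otimes> inv x \<otimes> inv y = c"
      using x y by (simp add: m_assoc inv_solve_right)
    with c show "x \<otimes> y \<otimes> inv x \<otimes> inv y \<in> center G" by simp
  qed
  ultimately show ?thesis
    using generate_subgroup_incl group_axioms unfolding two_nilpotent_def derived_def by blast
qed

text \<open>The equation determines \<open>z\<close> as the commutator of \<open>x\<close> and
  \<open>y\<close>.\<close>

lemma two_nilpotent_commutator:
  fixes G (structure)
  assumes "two_nilpotent G" "x \<in> carrier G" "y \<in> carrier G" "z \<in> carrier G"
    and "x \<otimes>\<^bsub>G\<^esub> y = z \<otimes>\<^bsub>G\<^esub> (y \<otimes>\<^bsub>G\<^esub> x)"
  shows "z \<in> center G"
proof -
  interpret group G using assms(1) by (simp add: two_nilpotent_def)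
  have "z = x \<otimes> y \<otimes> inv x \<otimes> inv y"
    using assms(2-5) by (simp add: m_assoc inv_solve_right)
  also have "\<dots> \<in> derived G (carrier G)"
    unfolding derived_def by (rule generate.incl) (use assms(2,3) in blast)
  finally show ?thesis using assms(1) by (auto simp: two_nilpotent_def)
qed

lemma two_nilpotent_subgroup:
  fixes G (structure)
  assumes "two_nilpotent G" "subgroup H G"
  shows "two_nilpotent (G\<lparr>carrier := H\<rparr>)"
proof (rule two_nilpotentI)
  interpret group G using assms(1) by (simp add: two_nilpotent_def)
  show "group (G\<lparr>carrier := H\<rparr>)"
    by (rule subgroup.subgroup_is_group[OF assms(2)]) (rule group_axioms)
  fix x y assume xy: "x \<in> carrier (G\<lparr>carrier := H\<rparr>)" "y \<in> carrier (G\<lparr>carrier := H\<rparr>)"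
  interpret H: subgroup H G by fact
  \<comment> \<open>The commutator formed in \<open>G\<close> already lies in \<open>H\<close>, and
    an element of \<open>H\<close> that is central in \<open>G\<close> is central in
    \<open>H\<close>.\<close>
  let ?c = "x \<otimes> y \<otimes> inv (y \<otimes> x)"
  have c: "?c \<in> H" and eq: "x \<otimes> y = ?c \<otimes> (y \<otimes> x)"
    using xy by (auto simp: m_assoc)
  have "?c \<in> center G"
    by (rule two_nilpotent_commutator[OF assms(1) _ _ _ eq]) (use xy c in auto)
  then have "?c \<in> center (G\<lparr>carrier := H\<rparr>)"
    using c by (auto simp: center_def)
  with eq show "\<exists>c\<in>center (G\<lparr>carrier := H\<rparr>). x \<otimes>\<^bsub>G\<lparr>carrier := H\<rparr>\<^esub> y =
      c \<otimes>\<^bsub>G\<lparr>carrier := H\<rparr>\<^esub> (y \<otimes>\<^bsub>G\<lparr>carrier := H\<rparr>\<^esub> x)"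
    by auto
qed

text \<open>Serves to move a concrete group onto a carrier inside the type
  \<open>'u\<close>.\<close>

lemma two_nilpotent_image_group:
  fixes G (structure)
  assumes "two_nilpotent G" "inj_on f (carrier G)"
  shows "two_nilpotent (image_group f G)"
proof (rule two_nilpotentI)
  interpret group G using assms(1) by (simp add: two_nilpotent_def)
  show "group (image_group f G)"
    by (rule inj_imp_image_group_is_group[OF assms(2)])
  have mult: "f x \<otimes>\<^bsub>image_group f G\<^esub> f y = f (x \<otimes> y)" if "x \<in> carrier G" "y \<in> carrier G" for x y
    using that assms(2) by (simp add: image_group_def)
  fix x y assume "x \<in> carrier (image_group f G)" "y \<in> carrier (image_group f G)"
  then obtain a b where ab: "x = f a" "y = f b" "a \<in> carrier G" "b \<in> carrier G"
    by (auto simp: image_group_carrier)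
  let ?c = "a \<otimes> b \<otimes> inv (b \<otimes> a)"
  have c: "?c \<in> carrier G" and eq: "a \<otimes> b = ?c \<otimes> (b \<otimes> a)"
    using ab by (auto simp: m_assoc)
  have "?c \<in> center G"
    by (rule two_nilpotent_commutator[OF assms(1) ab(3,4) c eq])
  then have "f ?c \<in> center (image_group f G)"
    using c by (auto simp: center_def image_group_carrier mult)
  moreover have "x \<otimes>\<^bsub>image_group f G\<^esub> y = f ?c \<otimes>\<^bsub>image_group f G\<^esub> (y \<otimes>\<^bsub>image_group f G\<^esub> x)"
    using ab c eq by (simp add: mult del: inv_mult_group)
  ultimately show "\<exists>c\<in>center (image_group f G). x \<otimes>\<^bsub>image_group f G\<^esub> y =
      c \<otimes>\<^bsub>image_group f G\<^esub> (y \<otimes>\<^bsub>image_group f G\<^esub> x)" by blast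
qed

section \<open>The category of 2-nilpotent groups\<close>

lemma Obj_Nil2Grp [simp]: "G \<in> Obj (Nil2Grp U) \<longleftrightarrow> two_nilpotent G \<and> carrier G \<in> U"
  by (simp add: Nil2Grp_def)

lemma Hom_Nil2Grp:
  "F \<in> Hom (Nil2Grp U) G H \<longleftrightarrow> (\<exists>h. F = (G, h, H) \<and> G \<in> Obj (Nil2Grp U) \<and> H \<in> Obj (Nil2Grp U) \<and>
     h \<in> hom G H \<inter> extensional (carrier G))"
  by (auto simp: Hom_def Nil2Grp_def)

lemma Cmp_Nil2Grp [simp]: "(H, k, K) \<star>\<^bsub>Nil2Grp U\<^esub> (G, h, H') = (G, compose (carrier G) k h, K)"
  by (simp add: Nil2Grp_def)

lemma Idt_Nil2Grp [simp]: "Idt (Nil2Grp U) G = (G, restrict id (carrier G), G)"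
  by (simp add: Nil2Grp_def)

text \<open>Homomorphisms given by a formula become arrows in this way: restriction makes them
  extensional, and closure of the carrier under multiplication keeps them homomorphisms.\<close>

lemma restrict_Hom_Nil2Grp:
  assumes "G \<in> Obj (Nil2Grp U)" "H \<in> Obj (Nil2Grp U)" "h \<in> hom G H"
  shows "(G, restrict h (carrier G), H) \<in> Hom (Nil2Grp U) G H"
proof -
  have "group G" using assms(1) by (simp add: two_nilpotent_def)
  then have "restrict h (carrier G) \<in> hom G H"
    using assms(3) by (auto simp: hom_def group.is_monoid monoid.m_closed)
  then show ?thesis using assms by (simp add: Hom_Nil2Grp)
qed

lemma is_category_Nil2Grp: "is_category (Nil2Grp U)"
proof -
  let ?C = "Nil2Grp U"
  have arr: "(G, h, H) \<in> Arr ?C \<longleftrightarrow> G \<in> Obj ?C \<and> H \<in> Obj ?C \<and> h \<in> hom G H \<inter> extensional (carrier G)"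
    for G h H by (auto simp: Nil2Grp_def)
  have dc: "Dom ?C (G, h, H) = G" "Cod ?C (G, h, H) = H" for G h H
    by (auto simp: Nil2Grp_def)
  show ?thesis
    unfolding is_category_def
  proof (intro conjI ballI impI)
    fix G assume "G \<in> Obj ?C"
    then show "Idt ?C G \<in> Hom ?C G G"
      using restrict_Hom_Nil2Grp[of G U G id] by (simp add: hom_def)
  next
    fix f g assume fg: "f \<in> Arr ?C" "g \<in> Arr ?C" "Cod ?C f = Dom ?C g"
    obtain G h H k K where e: "f = (G, h, H)" "g = (H, k, K)"
      using fg(3) by (cases f; cases g) (simp add: dc)
    have "(G, compose (carrier G) k h, K) \<in> Hom ?C G K"
      unfolding compose_def
      by (rule restrict_Hom_Nil2Grp) (use fg e in \<open>auto simp: arr hom_def Pi_iff\<close>)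
    then show "g \<star>\<^bsub>?C\<^esub> f \<in> Hom ?C (Dom ?C f) (Cod ?C g)"
      by (simp add: e dc)
  next
    fix f g h assume fg: "f \<in> Arr ?C" "g \<in> Arr ?C" "h \<in> Arr ?C" "Cod ?C f = Dom ?C g" "Cod ?C g = Dom ?C h"
    obtain G f' H g' K h' L where e: "f = (G, f', H)" "g = (H, g', K)" "h = (K, h', L)"
      using fg(4,5) by (cases f; cases g; cases h) (simp add: dc)
    have "f' \<in> carrier G \<rightarrow> carrier H" using fg e by (auto simp: arr hom_def)
    then show "h \<star>\<^bsub>?C\<^esub> (g \<star>\<^bsub>?C\<^esub> f) = (h \<star>\<^bsub>?C\<^esub> g) \<star>\<^bsub>?C\<^esub> f"
      using compose_assoc[of f' "carrier G" "carrier H" h' g'] by (simp add: e)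
  next
    fix f assume f: "f \<in> Arr ?C"
    obtain G h H where e: "f = (G, h, H)" by (cases f)
    have h: "h \<in> carrier G \<rightarrow> carrier H" "h \<in> extensional (carrier G)"
      using f by (auto simp: e arr hom_def)
    show "f \<star>\<^bsub>?C\<^esub> Idt ?C (Dom ?C f) = f" "Idt ?C (Cod ?C f) \<star>\<^bsub>?C\<^esub> f = f"
      using h by (auto simp: e dc compose_def restrict_def extensional_def fun_eq_iff)
  qed (auto simp: arr dc)
qed

lemma carrier_class_finite:
  assumes "carrier_class U" "finite A"
  shows "A \<in> U"
  using assms finite_lepoll_infinite unfolding carrier_class_def by blast

lemma carrier_class_subset:
  assumes "carrier_class U" "A \<in> U" "A' \<subseteq> A"
  shows "A' \<in> U"
  using assms subset_imp_lepoll unfolding carrier_class_def by blast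

section \<open>Kernels as pullbacks along an arrow from a trivial group\<close>

lemma group_hom_Nil2Grp:
  assumes "(G, h, H) \<in> Hom (Nil2Grp U) G H"
  shows "group_hom G H h"
  using assms by (auto simp: Hom_Nil2Grp two_nilpotent_def group_hom_def group_hom_axioms_def)

text \<open>As \<open>E\<close> is trivial, a cone over \<open>f\<close> and \<open>p\<close>
  amounts to a homomorphism into \<open>A\<close> that \<open>p\<close> sends to the unit, that is,
  one with values in the kernel.\<close>

lemma kernel_pullback:
  assumes U: "carrier_class U"
    and f: "(E, f, B) \<in> Hom (Nil2Grp U) E B" and E: "carrier E = {\<one>\<^bsub>E\<^esub>}"
    and p: "(A, p, B) \<in> Hom (Nil2Grp U) A B"
  defines "K \<equiv> A\<lparr>carrier := kernel A B p\<rparr>"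
  shows "is_pullback (Nil2Grp U) (E, f, B) (A, p, B) K
     (K, restrict (\<lambda>_. \<one>\<^bsub>E\<^esub>) (carrier K), E) (K, restrict id (carrier K), A)"
proof -
  let ?C = "Nil2Grp U"
  let ?u = "(K, restrict (\<lambda>_. \<one>\<^bsub>E\<^esub>) (carrier K), E)" and ?v = "(K, restrict id (carrier K), A)"
  interpret p: group_hom A B p by (rule group_hom_Nil2Grp[OF p])
  interpret f: group_hom E B f by (rule group_hom_Nil2Grp[OF f])
  have AE: "A \<in> Obj ?C" "E \<in> Obj ?C" using f p by (auto simp: Hom_Nil2Grp)
  have sub: "subgroup (kernel A B p) A" by (rule p.subgroup_kernel)
  then have K: "K \<in> Obj ?C"
    using AE two_nilpotent_subgroup[OF _ sub] carrier_class_subset[OF U, of "carrier A"]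
    by (auto simp: K_def subgroup.subset)
  have u: "?u \<in> Hom ?C K E"
    by (rule restrict_Hom_Nil2Grp[OF K AE(2)]) (simp add: hom_def)
  have v: "?v \<in> Hom ?C K A"
    by (rule restrict_Hom_Nil2Grp[OF K AE(1)])
       (use subgroup.mem_carrier[OF sub] in \<open>auto simp: hom_def K_def\<close>)
  \<comment> \<open>Both composites are constantly the unit of \<open>B\<close>.\<close>
  have fu: "(E, f, B) \<star>\<^bsub>?C\<^esub> ?u = (A, p, B) \<star>\<^bsub>?C\<^esub> ?v"
    by (auto simp: compose_def K_def kernel_def fun_eq_iff)
  have ex1: "\<exists>!w. w \<in> Hom ?C Q K \<and> ?u \<star>\<^bsub>?C\<^esub> w = a \<and> ?v \<star>\<^bsub>?C\<^esub> w = b"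
    if Q: "Q \<in> Obj ?C" and a: "a \<in> Hom ?C Q E" and b: "b \<in> Hom ?C Q A"
      and ab: "(E, f, B) \<star>\<^bsub>?C\<^esub> a = (A, p, B) \<star>\<^bsub>?C\<^esub> b" for Q a b
  proof -
    obtain a' where a': "a = (Q, a', E)" "a' \<in> hom Q E" "a' \<in> extensional (carrier Q)"
      using a by (auto simp: Hom_Nil2Grp)
    obtain b' where b': "b = (Q, b', A)" "b' \<in> hom Q A" "b' \<in> extensional (carrier Q)"
      using b by (auto simp: Hom_Nil2Grp)
    have a1: "a' x = \<one>\<^bsub>E\<^esub>" if "x \<in> carrier Q" for x
      using that a'(2) E by (auto simp: hom_def Pi_iff)
    have bk: "b' x \<in> carrier K" if "x \<in> carrier Q" for x
    proof -
      have "f (a' x) = p (b' x)"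
        using ab that by (auto simp: a' b' compose_def fun_eq_iff restrict_def split: if_splits)
      then show ?thesis
        using that a1[OF that] b'(2) by (auto simp: K_def kernel_def hom_def Pi_iff)
    qed
    show ?thesis
    proof (rule ex1I)
      have "(Q, b', K) \<in> Hom ?C Q K"
        using Q K b' bk by (simp add: Hom_Nil2Grp hom_def) (simp add: K_def)
      moreover have "compose (carrier Q) (restrict (\<lambda>_. \<one>\<^bsub>E\<^esub>) (carrier K)) b' = a'"
        by (rule extensionalityI[OF compose_extensional a'(3)]) (simp add: compose_def bk a1)
      moreover have "compose (carrier Q) (restrict id (carrier K)) b' = b'"
        by (rule extensionalityI[OF compose_extensional b'(3)]) (simp add: compose_def bk)
      ultimately show "(Q, b', K) \<in> Hom ?C Q K \<and> ?u \<star>\<^bsub>?C\<^esub> (Q, b', K) = a \<and> ?v \<star>\<^bsub>?C\<^esub> (Q, b', K) = b"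
        by (simp add: a' b')
    next
      fix w assume w: "w \<in> Hom ?C Q K \<and> ?u \<star>\<^bsub>?C\<^esub> w = a \<and> ?v \<star>\<^bsub>?C\<^esub> w = b"
      then obtain w' where w': "w = (Q, w', K)" "w' \<in> hom Q K" "w' \<in> extensional (carrier Q)"
        by (auto simp: Hom_Nil2Grp)
      have "compose (carrier Q) (restrict id (carrier K)) w' = b'"
        using w by (simp add: w' b')
      then have "w' = b'"
        by (intro extensionalityI[OF w'(3) b'(3)]) (use w'(2) in \<open>auto simp: compose_def hom_def Pi_iff\<close>)
      then show "w = (Q, b', K)" by (simp add: w')
    qed
  qed
  have "Dom ?C (E, f, B) = E" "Dom ?C (A, p, B) = A"
    using f p by (auto simp: Hom_def)
  then show ?thesis
    unfolding is_pullback_def using K u v fu ex1 by simp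
qed

text \<open>The chosen pullback is an arbitrary one, so it is compared with the kernel through the
  two universal properties: \<open>j\<close> and \<open>k\<close> are the comparison arrows, and
  \<open>v\<close> corresponds to the inclusion of the kernel.\<close>

lemma pullback_eq_kernel:
  assumes U: "carrier_class U"
    and f: "(E, f, B) \<in> Hom (Nil2Grp U) E B" and E: "carrier E = {\<one>\<^bsub>E\<^esub>}"
    and p: "(A, p, B) \<in> Hom (Nil2Grp U) A B"
    and pb: "is_pullback (Nil2Grp U) (E, f, B) (A, p, B) P u (P, v, A)"
  shows "inj_on v (carrier P)" "v ` carrier P = kernel A B p"
proof -
  let ?C = "Nil2Grp U"
  define K where "K = A\<lparr>carrier := kernel A B p\<rparr>"
  define i where "i = (K, restrict id (carrier K), A)"
  define t where "t = (K, restrict (\<lambda>_. \<one>\<^bsub>E\<^esub>) (carrier K), E)"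
  have pbK: "is_pullback ?C (E, f, B) (A, p, B) K t i"
    unfolding K_def i_def t_def by (rule kernel_pullback[OF U f E p])
  note D = is_pullbackD[OF pb f p] and DK = is_pullbackD[OF pbK f p]
  obtain j where j: "j \<in> Hom ?C P K" "t \<star>\<^bsub>?C\<^esub> j = u" "i \<star>\<^bsub>?C\<^esub> j = (P, v, A)"
    using DK(5)[OF D(1-4)] by blast
  obtain k where k: "k \<in> Hom ?C K P" "u \<star>\<^bsub>?C\<^esub> k = t" "(P, v, A) \<star>\<^bsub>?C\<^esub> k = i"
    using D(5)[OF DK(1-4)] by blast
  note C = is_category_Nil2Grp[of U]
  have I: "Idt ?C P \<in> Hom ?C P P" by (rule category_Idt[OF C D(1)])
  have "u \<star>\<^bsub>?C\<^esub> (k \<star>\<^bsub>?C\<^esub> j) = u" "(P, v, A) \<star>\<^bsub>?C\<^esub> (k \<star>\<^bsub>?C\<^esub> j) = (P, v, A)"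
    using category_assoc[OF C j(1) k(1)] D(2,3) j k by simp_all
  \<comment> \<open>The composite and the identity have the same components \<open>u\<close> and
    \<open>v\<close>, so they agree by uniqueness.\<close>
  then have kj: "k \<star>\<^bsub>?C\<^esub> j = Idt ?C P"
    using D(5)[OF D(1-4)] I category_comp_Idt(1)[OF C D(2)] category_comp_Idt(1)[OF C D(3)]
      category_Hom_comp[OF C j(1) k(1)] by metis
  obtain j' k' where j': "j = (P, j', K)" "j' \<in> hom P K" and k': "k = (K, k', P)" "k' \<in> hom K P"
    using j(1) k(1) by (auto simp: Hom_Nil2Grp)
  have "j' x = v x" if "x \<in> carrier P" for x
    using j(3) j'(2) that by (auto simp: j'(1) i_def compose_def hom_def Pi_iff dest!: fun_cong[of _ _ x])
  moreover have "k' (j' x) = x" if "x \<in> carrier P" for x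
    using kj that by (auto simp: j' k' compose_def dest!: fun_cong[of _ _ x])
  ultimately show "inj_on v (carrier P)" by (metis inj_onI)
  \<comment> \<open>The map \<open>k'\<close> picks a preimage under \<open>v\<close> for each
    element of the kernel.\<close>
  have "v (k' x) = x" if "x \<in> carrier K" for x
    using k(3) that by (auto simp: k'(1) i_def compose_def dest!: fun_cong[of _ _ x])
  moreover have "k' x \<in> carrier P" if "x \<in> carrier K" for x
    using k'(2) that by (auto simp: hom_def)
  ultimately have "carrier K \<subseteq> v ` carrier P" by (metis image_eqI subsetI)
  moreover have "v ` carrier P \<subseteq> carrier K"
    using j'(2) \<open>\<And>x. x \<in> carrier P \<Longrightarrow> j' x = v x\<close> by (auto simp: hom_def Pi_iff)
  ultimately show "v ` carrier P = kernel A B p" by (simp add: K_def)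
qed

section \<open>The obstruction coming from a right adjoint\<close>

lemma Hom_to_trivial_unique:
  assumes "carrier E = {\<one>\<^bsub>E\<^esub>}" "F \<in> Hom (Nil2Grp U) G E" "F' \<in> Hom (Nil2Grp U) G E"
  shows "F = F'"
proof -
  obtain h h' where e: "F = (G, h, E)" "F' = (G, h', E)"
    and h: "h \<in> hom G E" "h' \<in> hom G E" "h \<in> extensional (carrier G)" "h' \<in> extensional (carrier G)"
    using assms by (auto simp: Hom_Nil2Grp)
  have "h = h'"
    by (rule extensionalityI[OF h(3,4)]) (use h(1,2) assms(1) in \<open>auto simp: hom_def Pi_iff\<close>)
  then show ?thesis by (simp add: e)
qed

text \<open>Together with uniqueness of arrows into \<open>E\<close>, this makes a trivial group a
  zero object. Compatibility with projections and sections is then automatic for points over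
  \<open>E\<close>.\<close>

lemma Hom_from_trivial_unique:
  assumes "carrier E = {\<one>\<^bsub>E\<^esub>}" "F \<in> Hom (Nil2Grp U) E G" "F' \<in> Hom (Nil2Grp U) E G"
  shows "F = F'"
proof -
  obtain h h' where e: "F = (E, h, G)" "F' = (E, h', G)"
    and h: "h \<in> extensional (carrier E)" "h' \<in> extensional (carrier E)"
    using assms by (auto simp: Hom_Nil2Grp)
  have "group_hom E G h" "group_hom E G h'"
    using assms(2,3) group_hom_Nil2Grp unfolding e by blast+
  then have "h \<one>\<^bsub>E\<^esub> = h' \<one>\<^bsub>E\<^esub>" by (simp add: group_hom.hom_one)
  then have "h = h'"
    by (intro extensionalityI[OF h]) (use assms(1) in auto)
  then show ?thesis by (simp add: e)
qed

text \<open>The hypothesis \<open>axz\<close> says that \<open>z\<close> is the commutator of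
  \<open>a\<close> and \<open>x\<close>. The element \<open>a\<close> need not lie in the kernel, so
  \<open>z\<close> can be a nontrivial commutator in \<open>A\<close> even when the kernel is
  abelian. The homomorphisms \<open>h1\<close> and \<open>h2\<close> are chosen independently, but
  both factor through one counit.\<close>

lemma LACC_kernel_homs_commute:
  assumes U: "carrier_class U" and lacc: "LACC (Nil2Grp U)"
    and X: "is_point (Nil2Grp U) B (A, (A, p, B), (B, s, A))"
    and H: "H \<in> Obj (Nil2Grp U)"
    and h1: "h1 \<in> hom (A\<lparr>carrier := kernel A B p\<rparr>) H"
    and h2: "h2 \<in> hom (A\<lparr>carrier := kernel A B p\<rparr>) H"
    and a: "a \<in> carrier A" and x: "x \<in> kernel A B p" and z: "z \<in> kernel A B p"
    and axz: "a \<otimes>\<^bsub>A\<^esub> x = z \<otimes>\<^bsub>A\<^esub> (x \<otimes>\<^bsub>A\<^esub> a)"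
  shows "h1 z \<otimes>\<^bsub>H\<^esub> h2 x = h2 x \<otimes>\<^bsub>H\<^esub> h1 z"
proof -
  let ?C = "Nil2Grp U"
  note C = is_category_Nil2Grp[of U]
  have p: "(A, p, B) \<in> Hom ?C A B" and B: "B \<in> Obj ?C"
    using X by (auto simp: is_point_iff Hom_Nil2Grp)
  interpret p: group_hom A B p by (rule group_hom_Nil2Grp[OF p])
  interpret H: group H using H by (simp add: two_nilpotent_def)

  \<comment> \<open>The inclusion \<open>f\<close> of the trivial subgroup is the arrow along which
    change of base takes kernels.\<close>
  define E where "E = B\<lparr>carrier := {\<one>\<^bsub>B\<^esub>}\<rparr>"
  define f where "f = (E, restrict id (carrier E), B)"
  have E: "E \<in> Obj ?C" and Etriv: "carrier E = {\<one>\<^bsub>E\<^esub>}"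
    using B two_nilpotent_subgroup[OF _ p.H.triv_subgroup] carrier_class_subset[OF U, of "carrier B" "{\<one>\<^bsub>B\<^esub>}"]
    by (auto simp: E_def)
  have f: "f \<in> Hom ?C E B"
    unfolding f_def by (rule restrict_Hom_Nil2Grp[OF E B]) (auto simp: hom_def E_def)

  \<comment> \<open>Kernels witness that all pullbacks along \<open>f\<close> exist, so the chosen
    ones are pullbacks.\<close>
  have ex: "\<exists>P u v. is_pullback ?C f q P u v" if q_Hom: "q \<in> Hom ?C G B" for G q
  proof -
    obtain q' where q: "q = (G, q', B)" using q_Hom by (auto simp: Hom_Nil2Grp)
    show ?thesis
      using kernel_pullback[OF U f[unfolded f_def] Etriv q_Hom[unfolded q]] unfolding f_def q by blast
  qed
  have cb_Hom: "FArr (change_of_base ?C f) F \<in> Hom (Pt ?C E)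
      (FObj (change_of_base ?C f) Z) (FObj (change_of_base ?C f) Z')"
    if F_Hom: "F \<in> Hom (Pt ?C B) Z Z'" for F Z Z'
  proof -
    obtain A1 p1 s1 A2 p2 s2 where Z: "Z = (A1, p1, s1)" "Z' = (A2, p2, s2)"
      by (cases Z; cases Z')
    obtain h where F: "F = (Z, h, Z')"
      using F_Hom unfolding Z by (auto simp: Hom_Pt)
    obtain P u v where ch: "chosen_pullback ?C f p1 = (P, u, v)" by (cases "chosen_pullback ?C f p1")
    obtain P' u' v' where ch': "chosen_pullback ?C f p2 = (P', u', v')" by (cases "chosen_pullback ?C f p2")
    show ?thesis
      by (rule change_of_base_arrE[OF C f ex F_Hom[unfolded F Z] ch ch'])
         (simp_all only: change_of_base_def F Z fctr.simps)
  qed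

  have fD: "f \<in> Arr ?C" "Dom ?C f = E" "Cod ?C f = B" using HomD[OF f] .
  have adj: "has_right_adjoint (Pt ?C B) (Pt ?C E) (change_of_base ?C f)"
    using lacc fD unfolding LACC_def by metis
  \<comment> \<open>The only way to regard \<open>H\<close> as a point over the zero object
    \<open>E\<close>.\<close>
  define tH where "tH = (H, restrict (\<lambda>_. \<one>\<^bsub>E\<^esub>) (carrier H), E)"
  define sH where "sH = (E, restrict (\<lambda>_. \<one>\<^bsub>H\<^esub>) (carrier E), H)"
  have tH: "tH \<in> Hom ?C H E"
    unfolding tH_def by (rule restrict_Hom_Nil2Grp[OF H E]) (auto simp: hom_def E_def)
  have sH: "sH \<in> Hom ?C E H"
    unfolding sH_def by (rule restrict_Hom_Nil2Grp[OF E H]) (auto simp: hom_def)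
  have Y: "is_point ?C E (H, tH, sH)"
    using tH sH Hom_to_trivial_unique[OF Etriv category_Hom_comp[OF C sH tH] category_Idt[OF C E]]
    by (simp add: is_point_iff)
  \<comment> \<open>The point \<open>R\<close> and the counit \<open>ee\<close> depend on
    \<open>H\<close> alone and will serve both \<open>h1\<close> and \<open>h2\<close>.\<close>
  obtain R ee where R: "is_point ?C B R"
    and ee: "ee \<in> Hom (Pt ?C E) (change_of_base_obj ?C f R) (H, tH, sH)"
    and fac: "\<And>h. h \<in> Hom (Pt ?C E) (change_of_base_obj ?C f (A, (A, p, B), (B, s, A))) (H, tH, sH) \<Longrightarrow>
        \<exists>\<alpha>\<in>Hom (Pt ?C B) (A, (A, p, B), (B, s, A)) R. h = ee \<star>\<^bsub>Pt ?C E\<^esub> change_of_base_arr ?C f \<alpha>"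
  proof (rule right_adjoint_factorization[OF is_category_Pt[OF C] is_category_Pt[OF C] cb_Hom adj])
    show "(H, tH, sH) \<in> Obj (Pt ?C E)" using Y by simp
  qed (use X in \<open>auto simp: change_of_base_def\<close>)

  obtain G q r where R_eq: "R = (G, (G, q, B), (B, r, G))"
    using R by (cases R) (auto simp: is_point_iff Hom_Nil2Grp)
  have q: "(G, q, B) \<in> Hom ?C G B" using R by (simp add: R_eq is_point_iff)
  have G: "two_nilpotent G" using q by (simp add: Hom_Nil2Grp)

  obtain P u v0 t where ch: "chosen_pullback ?C f (A, p, B) = (P, u, v0)"
    and pb: "is_pullback ?C f (A, p, B) P u v0"
    and FX: "change_of_base_obj ?C f (A, (A, p, B), (B, s, A)) = (P, u, t)"
    and FX_point: "is_point ?C E (P, u, t)"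
    by (rule change_of_base_objE[OF C f X ex[OF p]])
  note D = is_pullbackD[OF pb f p]
  obtain v where v0: "v0 = (P, v, A)" and v: "v \<in> hom P A"
    using D(3) by (auto simp: Hom_Nil2Grp)
  obtain P' u' w0 t' where ch': "chosen_pullback ?C f (G, q, B) = (P', u', w0)"
    and pb': "is_pullback ?C f (G, q, B) P' u' w0"
    and FR: "change_of_base_obj ?C f R = (P', u', t')"
    unfolding R_eq by (rule change_of_base_objE[OF C f R[unfolded R_eq] ex[OF q]])
  note D' = is_pullbackD[OF pb' f q]
  obtain w where w0: "w0 = (P', w, G)" and w: "(P', w, G) \<in> Hom ?C P' G"
    using D'(3) by (auto simp: Hom_Nil2Grp)
  interpret w: group_hom P' G w by (rule group_hom_Nil2Grp[OF w])
  \<comment> \<open>Injectivity of \<open>w\<close> will bring an equation in \<open>G\<close> back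
    to \<open>P'\<close>, the chosen kernel of \<open>R\<close>, where \<open>e\<close> can be
    applied.\<close>
  have inj: "inj_on w (carrier P')"
    using pullback_eq_kernel(1)[OF U _ Etriv q pb'[unfolded w0 f_def]] f unfolding f_def by blast
  have img: "v ` carrier P = kernel A B p"
    using pullback_eq_kernel(2)[OF U _ Etriv p pb[unfolded v0 f_def]] f unfolding f_def by blast

  obtain e where ee_eq: "ee = ((P', u', t'), (P', e, H), (H, tH, sH))" and e: "e \<in> hom P' H"
    using ee unfolding FR by (auto simp: Hom_Pt Hom_Nil2Grp)

  \<comment> \<open>Here \<open>k\<close> is the map induced by \<alpha> on the chosen kernels. Both
    vary with \<open>h\<close>, whereas \<open>w\<close> and \<open>e\<close> do not.\<close>
  have factor: "\<exists>\<alpha> k. \<alpha> \<in> hom A G \<and> k \<in> hom P P' \<and>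
      (\<forall>y\<in>carrier P. w (k y) = \<alpha> (v y) \<and> h (v y) = e (k y))"
    if h: "h \<in> hom (A\<lparr>carrier := kernel A B p\<rparr>) H" for h
  proof -
    \<comment> \<open>The homomorphism \<open>h\<close> lives on the actual kernel; composing with
      \<open>v\<close> transports it to the chosen pullback \<open>P\<close>.\<close>
    let ?h = "(P, restrict (h \<circ> v) (carrier P), H)"
    have "h \<circ> v \<in> hom P H"
      using h v imageI[of _ "carrier P" v] unfolding img by (auto simp: hom_def Pi_iff)
    then have hh: "?h \<in> Hom ?C P H"
      by (rule restrict_Hom_Nil2Grp[OF D(1) H])
    have t: "t \<in> Hom ?C E P" using FX_point by (simp add: is_point_iff)
    \<comment> \<open>The two triangles commute because arrows into and out of \<open>E\<close> are
      unique.\<close>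
    have "((P, u, t), ?h, (H, tH, sH)) \<in> Hom (Pt ?C E) (P, u, t) (H, tH, sH)"
      using FX_point Y hh Hom_to_trivial_unique[OF Etriv category_Hom_comp[OF C hh tH] D(2)]
        Hom_from_trivial_unique[OF Etriv category_Hom_comp[OF C t hh] sH]
      by (simp only: Hom_Pt) blast
    from fac[unfolded FX, OF this] obtain \<alpha>0 where
      \<alpha>0: "\<alpha>0 \<in> Hom (Pt ?C B) (A, (A, p, B), (B, s, A)) R"
      and eq: "((P, u, t), ?h, (H, tH, sH)) = ee \<star>\<^bsub>Pt ?C E\<^esub> change_of_base_arr ?C f \<alpha>0"
      by blast
    obtain \<alpha> where \<alpha>0_eq: "\<alpha>0 = ((A, (A, p, B), (B, s, A)), (A, \<alpha>, G), R)" and \<alpha>: "\<alpha> \<in> hom A G"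
      using \<alpha>0 unfolding R_eq by (auto simp: Hom_Pt Hom_Nil2Grp)
    obtain k0 where k0: "k0 \<in> Hom ?C P P'" "w0 \<star>\<^bsub>?C\<^esub> k0 = (A, \<alpha>, G) \<star>\<^bsub>?C\<^esub> v0"
      "change_of_base_arr ?C f \<alpha>0 = ((P, u, t), k0, (P', u', t'))"
      by (rule change_of_base_arrE[OF C f ex \<alpha>0[unfolded R_eq \<alpha>0_eq] ch ch',
            unfolded R_eq[symmetric] \<alpha>0_eq[symmetric] FX FR])
         (assumption | rule that)+
    obtain k where k0_eq: "k0 = (P, k, P')" and k: "k \<in> hom P P'"
      using k0(1) by (auto simp: Hom_Nil2Grp)
    have "compose (carrier P) w k = compose (carrier P) \<alpha> v"
      using k0(2) by (simp add: w0 v0 k0_eq)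
    then have "w (k y) = \<alpha> (v y)" if "y \<in> carrier P" for y
      using that by (metis compose_eq)
    moreover have "restrict (h \<circ> v) (carrier P) = compose (carrier P) e k"
      using eq by (simp add: k0(3) ee_eq k0_eq)
    then have "h (v y) = e (k y)" if "y \<in> carrier P" for y
      using that by (metis compose_eq restrict_apply' comp_apply)
    ultimately show ?thesis using \<alpha> k by blast
  qed

  obtain \<alpha> k where \<alpha>: "\<alpha> \<in> hom A G" and k: "k \<in> hom P P'"
    and \<alpha>k: "\<And>y. y \<in> carrier P \<Longrightarrow> w (k y) = \<alpha> (v y)" "\<And>y. y \<in> carrier P \<Longrightarrow> h1 (v y) = e (k y)"
    using factor[OF h1] by blast
  obtain \<beta> l where \<beta>: "\<beta> \<in> hom A G" and l: "l \<in> hom P P'"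
    and \<beta>l: "\<And>y. y \<in> carrier P \<Longrightarrow> w (l y) = \<beta> (v y)" "\<And>y. y \<in> carrier P \<Longrightarrow> h2 (v y) = e (l y)"
    using factor[OF h2] by blast
  obtain x' z' where x': "x' \<in> carrier P" "v x' = x" and z': "z' \<in> carrier P" "v z' = z"
    using x z img by (metis imageE)
  have xz: "x \<in> carrier A" "z \<in> carrier A" using x z by (auto simp: kernel_def)
  \<comment> \<open>The homomorphism \<alpha> carries \<open>axz\<close> to \<open>G\<close>, where
    2-nilpotency makes the commutator \<alpha> \<open>z\<close> central. It thus commutes with
    \<beta> \<open>x\<close>, although \<beta> comes from the other homomorphism.\<close>
  have "\<alpha> a \<otimes>\<^bsub>G\<^esub> \<alpha> x = \<alpha> z \<otimes>\<^bsub>G\<^esub> (\<alpha> x \<otimes>\<^bsub>G\<^esub> \<alpha> a)"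
    using axz \<alpha> a xz by (metis hom_mult p.G.m_closed)
  then have "\<alpha> z \<in> center G"
    by (rule two_nilpotent_commutator[OF G, rotated 3]) (use \<alpha> a xz in \<open>auto simp: hom_def\<close>)
  then have "\<alpha> z \<otimes>\<^bsub>G\<^esub> \<beta> x = \<beta> x \<otimes>\<^bsub>G\<^esub> \<alpha> z"
    using \<beta> xz by (auto simp: center_def hom_def)
  moreover have kl: "k z' \<in> carrier P'" "l x' \<in> carrier P'"
    using k l x' z' by (auto simp: hom_def)
  ultimately have "w (k z' \<otimes>\<^bsub>P'\<^esub> l x') = w (l x' \<otimes>\<^bsub>P'\<^esub> k z')"
    using \<alpha>k(1)[OF z'(1)] \<beta>l(1)[OF x'(1)] by (simp add: x' z')
  then have "k z' \<otimes>\<^bsub>P'\<^esub> l x' = l x' \<otimes>\<^bsub>P'\<^esub> k z'"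
    by (rule inj_onD[OF inj]) (use kl in simp_all)
  \<comment> \<open>Applying \<open>e\<close> turns \<open>k z'\<close> into \<open>h1 z\<close> and
    \<open>l x'\<close> into \<open>h2 x\<close>.\<close>
  then show ?thesis
    using \<alpha>k(2)[OF z'(1)] \<beta>l(2)[OF x'(1)] kl e by (metis hom_mult x'(2) z'(2))
qed

section \<open>The Heisenberg group modulo 2 and the counterexample\<close>

text \<open>The triple \<open>(a, b, c)\<close> stands for the unitriangular matrix with entries \<open>a\<close>, \<open>b\<close> next to the
  diagonal and \<open>c\<close> in the corner; \<open>\<noteq>\<close> on \<open>bool\<close> is addition modulo 2.\<close>

definition heis_mod2 :: "(bool \<times> bool \<times> bool) monoid" where
  "heis_mod2 = \<lparr>carrier = UNIV,
     mult = (\<lambda>(a, b, c) (a', b', c'). (a \<noteq> a', b \<noteq> b', c \<noteq> (c' \<noteq> (a \<and> b')))),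
     one = (False, False, False)\<rparr>"

lemma two_nilpotent_heis_mod2: "two_nilpotent heis_mod2"
proof (rule two_nilpotentI)
  show "group heis_mod2"
  proof (rule groupI)
    fix x assume "x \<in> carrier heis_mod2"
    obtain a b c where x: "x = (a, b, c)" by (cases x)
    \<comment> \<open>The inverse needs the corner correction \<open>a \<and> b\<close>, since
      \<open>(a, b, c)\<close> squares to a triple with that corner.\<close>
    show "\<exists>y\<in>carrier heis_mod2. y \<otimes>\<^bsub>heis_mod2\<^esub> x = \<one>\<^bsub>heis_mod2\<^esub>"
      by (rule bexI[of _ "(a, b, c \<noteq> (a \<and> b))"]) (auto simp: heis_mod2_def x)
  qed (auto simp: heis_mod2_def)
  fix x y :: "bool \<times> bool \<times> bool"
  obtain a b c a' b' c' where xy: "x = (a, b, c)" "y = (a', b', c')" by (cases x; cases y)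
  \<comment> \<open>The commutator has zeros next to the diagonal and the determinant of the two
    pairs, modulo 2, in the corner.\<close>
  show "\<exists>z\<in>center heis_mod2. x \<otimes>\<^bsub>heis_mod2\<^esub> y = z \<otimes>\<^bsub>heis_mod2\<^esub> (y \<otimes>\<^bsub>heis_mod2\<^esub> x)"
    by (rule bexI[of _ "(False, False, (a \<and> b') \<noteq> (a' \<and> b))"]) (auto simp: heis_mod2_def xy center_def)
qed

theorem theorem4p1:
  fixes U :: "'u set set"
  assumes "carrier_class U"
  shows "\<not> LACC (Nil2Grp U)"
proof
  assume lacc: "LACC (Nil2Grp U)"
  let ?C = "Nil2Grp U"
  obtain S where "S \<in> U" "infinite S" using assms by (auto simp: carrier_class_def)
  \<comment> \<open>Carriers must consist of elements of \<open>'u\<close>; an infinite member of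
    \<open>U\<close> leaves room for eight of them.\<close>
  then obtain i :: "bool \<times> bool \<times> bool \<Rightarrow> 'u" where i: "inj i"
    using finite_lepoll_infinite[of S "UNIV :: (bool \<times> bool \<times> bool) set"] by (auto simp: lepoll_def)
  define A where "A = image_group i heis_mod2"
  have carrier_A: "carrier A = range i" and one_A: "\<one>\<^bsub>A\<^esub> = i (False, False, False)"
    and mult_A: "\<And>a b c a' b' c'. i (a, b, c) \<otimes>\<^bsub>A\<^esub> i (a', b', c') =
       i (a \<noteq> a', b \<noteq> b', c \<noteq> (c' \<noteq> (a \<and> b')))"
    using i by (simp_all add: A_def image_group_def heis_mod2_def)
  have A: "A \<in> Obj ?C"
    using two_nilpotent_image_group[OF two_nilpotent_heis_mod2, of i] i
      carrier_class_finite[OF assms, of "range i"]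
    by (simp add: A_def[symmetric] carrier_A inj_on_subset)
  interpret A: group A using A by (simp add: two_nilpotent_def)

  \<comment> \<open>The subgroup generated by the first standard generator; each of its elements is
    its own inverse.\<close>
  define B where "B = A\<lparr>carrier := range (\<lambda>a. i (a, False, False))\<rparr>"
  have "subgroup (range (\<lambda>a. i (a, False, False))) A"
  proof (rule A.subgroupI)
    fix g assume "g \<in> range (\<lambda>a. i (a, False, False))"
    then have "g \<otimes>\<^bsub>A\<^esub> g = \<one>\<^bsub>A\<^esub>" "g \<in> carrier A" by (auto simp: mult_A one_A carrier_A)
    then have "inv\<^bsub>A\<^esub> g = g" by (simp add: A.inv_equality)
    with \<open>g \<in> range _\<close> show "inv\<^bsub>A\<^esub> g \<in> range (\<lambda>a. i (a, False, False))" by simp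
  qed (auto simp: carrier_A mult_A)
  then have B: "B \<in> Obj ?C"
    using A two_nilpotent_subgroup carrier_class_finite[OF assms] by (auto simp: B_def)

  define \<pi> where "\<pi> g = i (fst (the_inv i g), False, False)" for g
  have \<pi>_i: "\<pi> (i (a, b, c)) = i (a, False, False)" for a b c
    using i by (simp add: \<pi>_def the_inv_f_f)
  define p where "p = restrict \<pi> (carrier A)"
  define s where "s = restrict id (carrier B)"
  have p: "(A, p, B) \<in> Hom ?C A B"
    unfolding p_def
    by (rule restrict_Hom_Nil2Grp[OF A B]) (auto simp: hom_def B_def carrier_A \<pi>_i mult_A)
  have s: "(B, s, A) \<in> Hom ?C B A"
    unfolding s_def
    by (rule restrict_Hom_Nil2Grp[OF B A]) (auto simp: hom_def B_def carrier_A)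
  have ps: "compose (carrier B) p s = restrict id (carrier B)"
    by (auto simp: compose_def p_def s_def fun_eq_iff B_def carrier_A \<pi>_i)
  have X: "is_point ?C B (A, (A, p, B), (B, s, A))"
    using p s by (simp add: is_point_iff ps)
  \<comment> \<open>With first entry zero the term \<open>a \<and> b'\<close> vanishes, so
    multiplication in the kernel is coordinatewise addition.\<close>
  have ker: "kernel A B p = range (\<lambda>(b, c). i (False, b, c))"
    using i by (auto simp: kernel_def p_def carrier_A \<pi>_i B_def one_A inj_eq image_iff)

  \<comment> \<open>On the kernel, \<open>h1\<close> sends the commutator \<open>z\<close> to the
    generator \<open>a\<close> and kills \<open>x\<close>, while \<open>h2\<close> fixes
    \<open>x\<close> and kills \<open>z\<close>. They are homomorphisms there because the
    coordinates are additive on the kernel.\<close>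
  define h1 where "h1 g = i (snd (snd (the_inv i g)), False, False)" for g
  define h2 where "h2 g = i (False, fst (snd (the_inv i g)), False)" for g
  have h1_i: "h1 (i (a, b, c)) = i (c, False, False)" and h2_i: "h2 (i (a, b, c)) = i (False, b, False)"
    for a b c using i by (simp_all add: h1_def h2_def the_inv_f_f)
  have "h1 (i (False, False, True)) \<otimes>\<^bsub>A\<^esub> h2 (i (False, True, False)) =
      h2 (i (False, True, False)) \<otimes>\<^bsub>A\<^esub> h1 (i (False, False, True))"
  proof (rule LACC_kernel_homs_commute[OF assms lacc X A, where ?h1.0 = h1 and ?h2.0 = h2
        and a = "i (True, False, False)"])
    show "h1 \<in> hom (A\<lparr>carrier := kernel A B p\<rparr>) A" "h2 \<in> hom (A\<lparr>carrier := kernel A B p\<rparr>) A"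
      by (auto simp: hom_def ker carrier_A h1_i h2_i mult_A)
  qed (auto simp: ker carrier_A mult_A)
  \<comment> \<open>The two products are those of the standard generators in the two orders; they
    differ in the corner.\<close>
  then show False
    using i by (simp add: h1_i h2_i mult_A inj_eq)
qed

end
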